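(* For each even-cyclic $\mathrm{L}^{\circlearrowleft}$-grammar $Gr$ it holds that $L(Gr^{\not\circlearrowleft})\subseteq L(Gr)\subseteq L\big((Gr^{\not\circlearrowleft})^{\mathrm{CS}}\big)$.
   Context: Fix a set $Pr$ of primitive types. Types of $\mathrm{L}$ and of $\mathrm{L}+(\mathrm{CS})$ are built from primitive types using the binary connectives $\backslash$, $/$, $\cdot$; types of $\mathrm{L}^{\circlearrowleft}$ are built using $\backslash$, $/$, $\cdot$ and a unary connective $A\mapsto A^{\circlearrowleft}$. A sequent is $A_1,\dots,A_n\to B$ with $n\ge 1$ and $A_i,B$ types. Capital Latin letters denote types, $\Gamma,\Delta$ finite (possibly empty) sequences of types, $\Pi,\Psi$ nonempty finite sequences of types. The Lambek calculus $\mathrm{L}$ has the axioms and rules: - $(\mathrm{Ax})$: $A\to A$. - $(\backslash\to)$: from $\Gamma,B,\Delta\to C$ and $\Pi\to A$ infer $\Gamma,\Pi,A\backslash B,\Delta\to C$. - $(\to\backslash)$: from $A,\Pi\to B$ infer $\Pi\to A\backslash B$. - $(/\to)$: from $\Gamma,B,\Delta\to C$ and $\Pi\to A$ infer $\Gamma,B/A,\Pi,\Delta\to C$. - $(\to/)$: from $\Pi,A\to B$ infer $\Pi\to B/A$. - $(\cdot\to)$: from $\Gamma,A,B,\Delta\to C$ infer $\Gamma,A\cdot B,\Delta\to C$. - $(\to\cdot)$: from $\Pi\to A$ and $\Psi\to B$ infer $\Pi,\Psi\to A\cdot B$. - $(\mathrm{cut})$: from $\Pi\to A$ and $\Gamma,A,\Delta\to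 B$ infer $\Gamma,\Pi,\Delta\to B$. $\mathrm{L}+(\mathrm{CS})$ is obtained from $\mathrm{L}$ by adding the rule $(\mathrm{CS})$: from $\Pi,\Psi\to A$ infer $\Psi,\Pi\to A$. $\mathrm{L}^{\circlearrowleft}$ is obtained from $\mathrm{L}$ by adding the connective $^{\circlearrowleft}$ (the rules above apply to all types of $\mathrm{L}^{\circlearrowleft}$) and the rules $(\to^{\circlearrowleft})$: from $\Pi\to A$ infer $\Pi\to A^{\circlearrowleft}$; $(^{\circlearrowleft}\to)$: from $B\to A^{\circlearrowleft}$ infer $B^{\circlearrowleft}\to A^{\circlearrowleft}$; $(\circlearrowleft)$: from $\Pi,\Psi\to A^{\circlearrowleft}$ infer $\Psi,\Pi\to A^{\circlearrowleft}$. Grammars. For a calculus $\mathcal{K}$ among these, a $\mathcal{K}$-grammar is a triple $G=\langle\Sigma,S,\triangleright\rangle$ where $\Sigma$ is a finite alphabet, $S$ is a distinguished type of $\mathcal{K}$, and $\triangleright$ is a finite binary relation between $\Sigma$ and the types of $\mathcal{K}$. Its dictionary is the set of types $T$ such that $a\triangleright T$ for some $a\in\Sigma$. The language recognized by $G$ is $L(G)=\{a_1\dots a_n\in\Sigma^+\mid \exists\,T_1,\dots,T_n:\ a_i\triangleright T_i\text{ for all }i,\text{ and } \mathcal{K}\vdash T_1,\dots,T_n\to S\}$, where $\mathcal{K}\vdash$ means derivability in $\mathcal{K}$. Parity. For a type $A$ and a subtype $B$ of $A$, "$B$ is even in $A$" and "$B$ is odd in $A$" are defined by simultaneous recursion.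 $B$ is even in $A$ if: $A=B$; or $A=C^{\circlearrowleft}$ and $B$ is even in $C$; or $A=C\cdot D$ and $B$ is even in $C$ or in $D$; or $A=C\backslash D$ or $A=D/C$, and $B$ is odd in $C$ or even in $D$. $B$ is odd in $A$ if: $A=C^{\circlearrowleft}$ and $B$ is odd in $C$; or $A=C\cdot D$ and $B$ is odd in $C$ or in $D$; or $A=C\backslash D$ or $A=D/C$, and $B$ is even in $C$ or odd in $D$. A type is even-cyclic if it contains no odd subtype of the form $B^{\circlearrowleft}$; it is odd-cyclic if it contains no even subtype of the form $B^{\circlearrowleft}$. An $\mathrm{L}^{\circlearrowleft}$-grammar $\langle\Sigma,S,\triangleright\rangle$ is even-cyclic if all types in its dictionary are odd-cyclic and $S$ is even-cyclic. For a type $A$ of $\mathrm{L}^{\circlearrowleft}$, $A^{\not\circlearrowleft}$ is obtained from $A$ by removing all occurrences of the connective $^{\circlearrowleft}$. For an $\mathrm{L}^{\circlearrowleft}$-grammar $Gr=\langle\Sigma,S,\triangleright\rangle$, $Gr^{\not\circlearrowleft}$ is the $\mathrm{L}$-grammar obtained by replacing $S$ by $S^{\not\circlearrowleft}$ and each pair $a\triangleright T$ by $a\triangleright T^{\not\circlearrowleft}$. For an $\mathrm{L}$-grammar $G$, $G^{\mathrm{CS}}$ denotes the same triple considered as an $(\mathrm{L}+(\mathrm{CS}))$-grammar. *)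

theory Defs
  imports Main
begin

text \<open>
  Primitive types are the elements of the type parameter \<open>'p\<close>.
  In both datatypes, \<open>Under A B\<close> stands for the left division of \<open>B\<close> by \<open>A\<close> (argument \<open>A\<close> on
  the left, result \<open>B\<close>) and \<open>Over B A\<close> for the right division \<open>B / A\<close> (result \<open>B\<close>, argument \<open>A\<close>
  on the right).
\<close>

datatype 'p ltype =
    Prim 'p
  | Under "'p ltype" "'p ltype"
  | Over "'p ltype" "'p ltype"
  | Prod "'p ltype" "'p ltype"

datatype 'p ctype =
    CPrim 'p
  | CUnder "'p ctype" "'p ctype"
  | COver "'p ctype" "'p ctype"
  | CProd "'p ctype" "'p ctype"
  | Circ "'p ctype"

text \<open>
  A sequent is given by its antecedent (a list of types) and its succedent.  The variables
  \<open>\<Pi>\<close>, \<open>\<Psi>\<close> range over nonempty sequences, so that no derivable sequent has an empty antecedent.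
\<close>

inductive L_derivable :: "'p ltype list \<Rightarrow> 'p ltype \<Rightarrow> bool" where
  Ax: "L_derivable [A] A"
| UnderL: "L_derivable (\<Gamma> @ [B] @ \<Delta>) C \<Longrightarrow> L_derivable \<Pi> A \<Longrightarrow> \<Pi> \<noteq> []
    \<Longrightarrow> L_derivable (\<Gamma> @ \<Pi> @ [Under A B] @ \<Delta>) C"
| UnderR: "L_derivable ([A] @ \<Pi>) B \<Longrightarrow> \<Pi> \<noteq> [] \<Longrightarrow> L_derivable \<Pi> (Under A B)"
| OverL: "L_derivable (\<Gamma> @ [B] @ \<Delta>) C \<Longrightarrow> L_derivable \<Pi> A \<Longrightarrow> \<Pi> \<noteq> []
    \<Longrightarrow> L_derivable (\<Gamma> @ [Over B A] @ \<Pi> @ \<Delta>) C"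
| OverR: "L_derivable (\<Pi> @ [A]) B \<Longrightarrow> \<Pi> \<noteq> [] \<Longrightarrow> L_derivable \<Pi> (Over B A)"
| ProdL: "L_derivable (\<Gamma> @ [A, B] @ \<Delta>) C \<Longrightarrow> L_derivable (\<Gamma> @ [Prod A B] @ \<Delta>) C"
| ProdR: "L_derivable \<Pi> A \<Longrightarrow> L_derivable \<Psi> B \<Longrightarrow> \<Pi> \<noteq> [] \<Longrightarrow> \<Psi> \<noteq> []
    \<Longrightarrow> L_derivable (\<Pi> @ \<Psi>) (Prod A B)"
| Cut: "L_derivable \<Pi> A \<Longrightarrow> L_derivable (\<Gamma> @ [A] @ \<Delta>) B \<Longrightarrow> \<Pi> \<noteq> []
    \<Longrightarrow> L_derivable (\<Gamma> @ \<Pi> @ \<Delta>) B"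

inductive LCS_derivable :: "'p ltype list \<Rightarrow> 'p ltype \<Rightarrow> bool" where
  Ax: "LCS_derivable [A] A"
| UnderL: "LCS_derivable (\<Gamma> @ [B] @ \<Delta>) C \<Longrightarrow> LCS_derivable \<Pi> A \<Longrightarrow> \<Pi> \<noteq> []
    \<Longrightarrow> LCS_derivable (\<Gamma> @ \<Pi> @ [Under A B] @ \<Delta>) C"
| UnderR: "LCS_derivable ([A] @ \<Pi>) B \<Longrightarrow> \<Pi> \<noteq> [] \<Longrightarrow> LCS_derivable \<Pi> (Under A B)"
| OverL: "LCS_derivable (\<Gamma> @ [B] @ \<Delta>) C \<Longrightarrow> LCS_derivable \<Pi> A \<Longrightarrow> \<Pi> \<noteq> []
    \<Longrightarrow> LCS_derivable (\<Gamma> @ [Over B A] @ \<Pi> @ \<Delta>) C"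
| OverR: "LCS_derivable (\<Pi> @ [A]) B \<Longrightarrow> \<Pi> \<noteq> [] \<Longrightarrow> LCS_derivable \<Pi> (Over B A)"
| ProdL: "LCS_derivable (\<Gamma> @ [A, B] @ \<Delta>) C \<Longrightarrow> LCS_derivable (\<Gamma> @ [Prod A B] @ \<Delta>) C"
| ProdR: "LCS_derivable \<Pi> A \<Longrightarrow> LCS_derivable \<Psi> B \<Longrightarrow> \<Pi> \<noteq> [] \<Longrightarrow> \<Psi> \<noteq> []
    \<Longrightarrow> LCS_derivable (\<Pi> @ \<Psi>) (Prod A B)"
| Cut: "LCS_derivable \<Pi> A \<Longrightarrow> LCS_derivable (\<Gamma> @ [A] @ \<Delta>) B \<Longrightarrow> \<Pi> \<noteq> []
    \<Longrightarrow> LCS_derivable (\<Gamma> @ \<Pi> @ \<Delta>) B"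
| CS: "LCS_derivable (\<Pi> @ \<Psi>) A \<Longrightarrow> \<Pi> \<noteq> [] \<Longrightarrow> \<Psi> \<noteq> [] \<Longrightarrow> LCS_derivable (\<Psi> @ \<Pi>) A"

inductive LC_derivable :: "'p ctype list \<Rightarrow> 'p ctype \<Rightarrow> bool" where
  Ax: "LC_derivable [A] A"
| UnderL: "LC_derivable (\<Gamma> @ [B] @ \<Delta>) C \<Longrightarrow> LC_derivable \<Pi> A \<Longrightarrow> \<Pi> \<noteq> []
    \<Longrightarrow> LC_derivable (\<Gamma> @ \<Pi> @ [CUnder A B] @ \<Delta>) C"
| UnderR: "LC_derivable ([A] @ \<Pi>) B \<Longrightarrow> \<Pi> \<noteq> [] \<Longrightarrow> LC_derivable \<Pi> (CUnder A B)"
| OverL: "LC_derivable (\<Gamma> @ [B] @ \<Delta>) C \<Longrightarrow> LC_derivable \<Pi> A \<Longrightarrow> \<Pi> \<noteq> []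
    \<Longrightarrow> LC_derivable (\<Gamma> @ [COver B A] @ \<Pi> @ \<Delta>) C"
| OverR: "LC_derivable (\<Pi> @ [A]) B \<Longrightarrow> \<Pi> \<noteq> [] \<Longrightarrow> LC_derivable \<Pi> (COver B A)"
| ProdL: "LC_derivable (\<Gamma> @ [A, B] @ \<Delta>) C \<Longrightarrow> LC_derivable (\<Gamma> @ [CProd A B] @ \<Delta>) C"
| ProdR: "LC_derivable \<Pi> A \<Longrightarrow> LC_derivable \<Psi> B \<Longrightarrow> \<Pi> \<noteq> [] \<Longrightarrow> \<Psi> \<noteq> []
    \<Longrightarrow> LC_derivable (\<Pi> @ \<Psi>) (CProd A B)"
| Cut: "LC_derivable \<Pi> A \<Longrightarrow> LC_derivable (\<Gamma> @ [A] @ \<Delta>) B \<Longrightarrow> \<Pi> \<noteq> []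
    \<Longrightarrow> LC_derivable (\<Gamma> @ \<Pi> @ \<Delta>) B"
| CircR: "LC_derivable \<Pi> A \<Longrightarrow> \<Pi> \<noteq> [] \<Longrightarrow> LC_derivable \<Pi> (Circ A)"
| CircL: "LC_derivable [B] (Circ A) \<Longrightarrow> LC_derivable [Circ B] (Circ A)"
| CircRot: "LC_derivable (\<Pi> @ \<Psi>) (Circ A) \<Longrightarrow> \<Pi> \<noteq> [] \<Longrightarrow> \<Psi> \<noteq> []
    \<Longrightarrow> LC_derivable (\<Psi> @ \<Pi>) (Circ A)"

text \<open>
  A grammar over types in \<open>'t\<close>.  The record does not fix the calculus; which calculus a grammar
  is considered in is determined by the language function applied to it.
\<close>

record ('a, 't) grammar =
  alphabet :: "'a set"
  distinguished :: 't
  assigns :: "('a \<times> 't) set"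

definition is_grammar :: "('a, 't) grammar \<Rightarrow> bool" where
  "is_grammar G \<longleftrightarrow> finite (alphabet G) \<and> finite (assigns G) \<and> assigns G \<subseteq> alphabet G \<times> UNIV"

definition dictionary :: "('a, 't) grammar \<Rightarrow> 't set" where
  "dictionary G = {T. \<exists>a \<in> alphabet G. (a, T) \<in> assigns G}"

definition language :: "('t list \<Rightarrow> 't \<Rightarrow> bool) \<Rightarrow> ('a, 't) grammar \<Rightarrow> 'a list set" where
  "language derivable G = {w. w \<noteq> [] \<and> set w \<subseteq> alphabet G \<and>
     (\<exists>Ts. list_all2 (\<lambda>a T. (a, T) \<in> assigns G) w Ts \<and> derivable Ts (distinguished G))}"

definition L_language :: "('a, 'p ltype) grammar \<Rightarrow> 'a list set" where
  "L_language = language L_derivable"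

definition LCS_language :: "('a, 'p ltype) grammar \<Rightarrow> 'a list set" where
  "LCS_language = language LCS_derivable"

definition LC_language :: "('a, 'p ctype) grammar \<Rightarrow> 'a list set" where
  "LC_language = language LC_derivable"

text \<open>
  \<open>even_in B A\<close>: \<open>B\<close> is even in \<open>A\<close>; \<open>odd_in B A\<close>: \<open>B\<close> is odd in \<open>A\<close>.  Both may hold, if \<open>B\<close> has
  several occurrences in \<open>A\<close>.
\<close>

fun even_in :: "'p ctype \<Rightarrow> 'p ctype \<Rightarrow> bool"
  and odd_in :: "'p ctype \<Rightarrow> 'p ctype \<Rightarrow> bool" where
  "even_in B (CPrim p) \<longleftrightarrow> B = CPrim p"
| "even_in B (Circ C) \<longleftrightarrow> B = Circ C \<or> even_in B C"
| "even_in B (CProd C D) \<longleftrightarrow> B = CProd C D \<or> even_in B C \<or> even_in B D"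
| "even_in B (CUnder C D) \<longleftrightarrow> B = CUnder C D \<or> odd_in B C \<or> even_in B D"
| "even_in B (COver D C) \<longleftrightarrow> B = COver D C \<or> odd_in B C \<or> even_in B D"
| "odd_in B (CPrim p) \<longleftrightarrow> False"
| "odd_in B (Circ C) \<longleftrightarrow> odd_in B C"
| "odd_in B (CProd C D) \<longleftrightarrow> odd_in B C \<or> odd_in B D"
| "odd_in B (CUnder C D) \<longleftrightarrow> even_in B C \<or> odd_in B D"
| "odd_in B (COver D C) \<longleftrightarrow> even_in B C \<or> odd_in B D"

definition even_cyclic :: "'p ctype \<Rightarrow> bool" where
  "even_cyclic A \<longleftrightarrow> \<not> (\<exists>B. odd_in (Circ B) A)"

definition odd_cyclic :: "'p ctype \<Rightarrow> bool" where
  "odd_cyclic A \<longleftrightarrow> \<not> (\<exists>B. even_in (Circ B) A)"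

definition even_cyclic_grammar :: "('a, 'p ctype) grammar \<Rightarrow> bool" where
  "even_cyclic_grammar G \<longleftrightarrow>
     is_grammar G \<and> (\<forall>T \<in> dictionary G. odd_cyclic T) \<and> even_cyclic (distinguished G)"

primrec strip :: "'p ctype \<Rightarrow> 'p ltype" where
  "strip (CPrim p) = Prim p"
| "strip (CUnder A B) = Under (strip A) (strip B)"
| "strip (COver B A) = Over (strip B) (strip A)"
| "strip (CProd A B) = Prod (strip A) (strip B)"
| "strip (Circ A) = strip A"

definition strip_grammar :: "('a, 'p ctype) grammar \<Rightarrow> ('a, 'p ltype) grammar" where
  "strip_grammar G = \<lparr> alphabet = alphabet G, distinguished = strip (distinguished G),
     assigns = {(a, strip T) | a T. (a, T) \<in> assigns G} \<rparr>"

lemma is_grammar_strip_grammar: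
  assumes "is_grammar G"
  shows "is_grammar (strip_grammar G)"
proof -
  have "assigns (strip_grammar G) = (\<lambda>(a, T). (a, strip T)) ` assigns G"
    by (force simp: strip_grammar_def)
  then show ?thesis
    using assms by (auto simp: is_grammar_def strip_grammar_def)
qed

end

theory Submission
  imports Defs
begin

text \<open>
  For the right inclusion, erasing \<open>Circ\<close> turns the three rules for \<open>Circ\<close> into trivial steps or
  instances of (CS).  For the left inclusion, a type \<open>T\<close> may be compared with its stripped version
  inside the calculus with \<open>Circ\<close>: since \<open>A\<close> entails \<open>Circ A\<close> and the polarity conditions
  allow \<open>Circ\<close> only at positions of one sign, an odd-cyclic type entails its stripped version and an
  even-cyclic type is entailed by it.  Cutting with these sequents carries a derivation in L over
  to the given grammar.
\<close>

lemma LC_derivable_strip: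
  "LC_derivable \<Gamma> A \<Longrightarrow> LCS_derivable (map strip \<Gamma>) (strip A)"
  by (induction rule: LC_derivable.induct) (auto intro: LCS_derivable.intros[simplified])

text \<open>The two datatypes are disjoint, so a copy of the stripped type is taken back into
  \<open>'p ctype\<close>, where it can be cut against the original.\<close>

primrec ctype_of :: "'p ltype \<Rightarrow> 'p ctype" where
  "ctype_of (Prim p) = CPrim p"
| "ctype_of (Under A B) = CUnder (ctype_of A) (ctype_of B)"
| "ctype_of (Over B A) = COver (ctype_of B) (ctype_of A)"
| "ctype_of (Prod A B) = CProd (ctype_of A) (ctype_of B)"

lemma L_derivable_ctype_of:
  "L_derivable \<Gamma> A \<Longrightarrow> LC_derivable (map ctype_of \<Gamma>) (ctype_of A)"
  by (induction rule: L_derivable.induct) (auto intro: LC_derivable.intros[simplified])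

text \<open>Division is contravariant in its denominator, which mirrors the parity flip in
  \<open>even_in\<close> and \<open>odd_in\<close>.\<close>

lemma CUnder_mono:
  assumes "LC_derivable [A'] A" "LC_derivable [B] B'"
  shows "LC_derivable [CUnder A B] (CUnder A' B')"
  using LC_derivable.UnderL[of "[]" B "[]" B' "[A']" A] assms
  by (auto intro: LC_derivable.UnderR)

lemma COver_mono:
  assumes "LC_derivable [A'] A" "LC_derivable [B] B'"
  shows "LC_derivable [COver B A] (COver B' A')"
  using LC_derivable.OverL[of "[]" B "[]" B' "[A']" A] assms
  by (auto intro: LC_derivable.OverR)

lemma CProd_mono:
  assumes "LC_derivable [A] A'" "LC_derivable [B] B'"
  shows "LC_derivable [CProd A B] (CProd A' B')"
  using LC_derivable.ProdL[of "[]" A B "[]" "CProd A' B'"]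
    LC_derivable.ProdR[of "[A]" A' "[B]" B'] assms by simp

text \<open>Both claims go through one induction because denominators exchange them. At
  \<open>Circ C\<close> the first is vacuous, as \<open>Circ C\<close> is even in itself, and the
  second is \<open>CircR\<close>.\<close>

lemma cyclic_ctype_of_strip:
  "odd_cyclic A \<Longrightarrow> LC_derivable [A] (ctype_of (strip A))"
  "even_cyclic A \<Longrightarrow> LC_derivable [ctype_of (strip A)] A"
  by (induction A)
    (auto simp: odd_cyclic_def even_cyclic_def
      intro: LC_derivable.Ax LC_derivable.CircR CUnder_mono COver_mono CProd_mono)

lemma LC_derivable_antecedents:
  assumes "list_all2 (\<lambda>T U. LC_derivable [T] U) Ts Us" "LC_derivable (\<Delta> @ Us) A"
  shows "LC_derivable (\<Delta> @ Ts) A"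
  using assms
proof (induction arbitrary: \<Delta> rule: list_all2_induct)
  case (Cons T Ts U Us)
  \<comment> \<open>The tail is replaced first, with \<open>U\<close> moved into the prefix; a cut
    then trades \<open>U\<close> for \<open>T\<close>.\<close>
  from Cons.IH[of "\<Delta> @ [U]"] Cons.prems have "LC_derivable (\<Delta> @ [U] @ Ts) A"
    by simp
  with LC_derivable.Cut[OF Cons.hyps(1)] show ?case
    by simp
qed simp

lemma L_derivable_strip_imp_LC_derivable:
  assumes "L_derivable (map strip Ts) (strip S)" "\<forall>T\<in>set Ts. odd_cyclic T" "even_cyclic S" "Ts \<noteq> []"
  shows "LC_derivable Ts S"
proof -
  have "list_all2 (\<lambda>T U. LC_derivable [T] U) Ts (map (\<lambda>T. ctype_of (strip T)) Ts)"
    using assms(2) by (simp add: list_all2_map2 list_all2_same cyclic_ctype_of_strip)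
  moreover have "LC_derivable ([] @ map (\<lambda>T. ctype_of (strip T)) Ts) (ctype_of (strip S))"
    using L_derivable_ctype_of[OF assms(1)] by (simp add: comp_def)
  ultimately have "LC_derivable Ts (ctype_of (strip S))"
    using LC_derivable_antecedents[where \<Delta> = "[]"] by simp
  \<comment> \<open>The succedent is adjusted by one cut with empty contexts.\<close>
  with LC_derivable.Cut[of Ts "ctype_of (strip S)" "[]" "[]" S] cyclic_ctype_of_strip(2)[OF assms(3)]
  show ?thesis
    using assms(4) by simp
qed

text \<open>Since \<open>strip\<close> is not injective, a preimage in the dictionary relation is
  chosen separately at each position of the word.\<close>

lemma list_all2_assigns_strip_grammar:
  "list_all2 (\<lambda>a U. (a, U) \<in> assigns (strip_grammar G)) w Us \<longleftrightarrow>
    (\<exists>Ts. Us = map strip Ts \<and> list_all2 (\<lambda>a T. (a, T) \<in> assigns G) w Ts)"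
proof (induction w arbitrary: Us)
  case (Cons a w)
  then show ?case
    by (cases Us) (auto simp: strip_grammar_def list_all2_Cons1 Cons_eq_map_conv)
qed auto

lemma set_subset_dictionary:
  assumes "list_all2 (\<lambda>a T. (a, T) \<in> assigns G) w Ts" "set w \<subseteq> alphabet G"
  shows "set Ts \<subseteq> dictionary G"
  using assms by (induction rule: list_all2_induct) (auto simp: dictionary_def)

theorem theorem9:
  fixes Gr :: "('a, 'p ctype) grammar"
  assumes "even_cyclic_grammar Gr"
  shows "L_language (strip_grammar Gr) \<subseteq> LC_language Gr
       \<and> LC_language Gr \<subseteq> LCS_language (strip_grammar Gr)"
proof (intro conjI subsetI)
  fix w assume "w \<in> L_language (strip_grammar Gr)"
  then obtain Us where w: "w \<noteq> []" "set w \<subseteq> alphabet Gr"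
    and Us: "list_all2 (\<lambda>a U. (a, U) \<in> assigns (strip_grammar Gr)) w Us"
    and L: "L_derivable Us (strip (distinguished Gr))"
    by (auto simp: L_language_def language_def strip_grammar_def)
  from Us obtain Ts where Ts: "Us = map strip Ts" "list_all2 (\<lambda>a T. (a, T) \<in> assigns Gr) w Ts"
    unfolding list_all2_assigns_strip_grammar by blast
  have "LC_derivable Ts (distinguished Gr)"
    using L Ts w set_subset_dictionary[OF Ts(2) w(2)] assms
    by (intro L_derivable_strip_imp_LC_derivable) (auto simp: even_cyclic_grammar_def)
  then show "w \<in> LC_language Gr"
    using w Ts(2) by (auto simp: LC_language_def language_def)
next
  fix w assume "w \<in> LC_language Gr"
  then obtain Ts where w: "w \<noteq> []" "set w \<subseteq> alphabet Gr"
    and Ts: "list_all2 (\<lambda>a T. (a, T) \<in> assigns Gr) w Ts"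
    and LC: "LC_derivable Ts (distinguished Gr)"
    by (auto simp: LC_language_def language_def)
  have "list_all2 (\<lambda>a U. (a, U) \<in> assigns (strip_grammar Gr)) w (map strip Ts)"
    using Ts list_all2_assigns_strip_grammar by blast
  with w LC_derivable_strip[OF LC] show "w \<in> LCS_language (strip_grammar Gr)"
    by (auto simp: LCS_language_def language_def strip_grammar_def)
qed

end
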